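(* Let $\mathcal{A}$ be the finite set of demand points and $\mathcal{R}=\{1,\ldots,R\}$ the finite set of regimes of the service system described in the context, with arrival rates $\Lambda_r$ and service rates $\mu_r>\Lambda_r$ ($r\in\mathcal{R}$), access times $t_a\ge 0$ ($a\in\mathcal{A}$) and total response time $R_a$ for demand point $a$. Then, for every $a\in\mathcal{A}$, $R_a$ follows a shifted hyperexponential distribution with cumulative distribution function $$\mathbb{P}(R_a\le t)=\begin{cases}0 & \text{if } t<t_a,\\[4pt] 1-\displaystyle\sum_{r\in\mathcal{R}}\pi_r\,e^{-(\mu_r-\Lambda_r)(t-t_a)} & \text{if } t\ge t_a,\end{cases}$$ and expectation $$\mathbb{E}[R_a]=t_a+\sum_{r\in\mathcal{R}}\frac{\pi_r}{\mu_r-\Lambda_r},$$ where $\pi_r:=\dfrac{\Lambda_r}{\sum_{r'\in\mathcal{R}}\Lambda_{r'}}$ for all $r\in\mathcal{R}$.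
   Context: Service system. Demand originates from a finite set of points $\mathcal{A}$; service is provided by finitely many parallel regimes $\mathcal{R}=\{1,\ldots,R\}$, each an independent single-server queue. Arrivals to regime $r$ form a Poisson process with rate $\Lambda_r\ge 0$, with $\sum_{r}\Lambda_r>0$. Service times in regime $r$ are i.i.d. exponential with rate $\mu_r>0$, the discipline is first-come first-served with unlimited waiting space, so regime $r$ is an $\mathrm{M}/\mathrm{M}/1$ queue, assumed stable: $\rho_r=\Lambda_r/\mu_r<1$. Each queue is in its stationary regime. An arriving customer from demand point $a$ first undergoes a deterministic, known access (transportation) time $t_a\ge 0$, and is then routed to exactly one regime; the selected regime is $r$ with probability $\pi_r=\Lambda_r/\sum_{r'}\Lambda_{r'}$. Equivalently, regime $r$ receives the fraction $\pi_r$ of the overall arrival rate $\Lambda=\sum_{r'}\Lambda_{r'}$. Conditional on regime $r$, the sojourn time $T$ of the customer is its stationary sojourn time (waiting time plus service time) in the $\mathrm{M}/\mathrm{M}/1$ queue with parameters $(\Lambda_r,\mu_r)$. The total (end-to-end) response time is $R_a:=t_a+T$. *)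

theory Defs
  imports "HOL-Probability.Probability"
begin

text \<open>
  A single-server queue is driven by the work \<open>Backlog\<close> still to be cleared when customer 0
  arrives, the time \<open>Interarrival n\<close> between the arrivals of customers \<open>n\<close> and \<open>n + 1\<close>,
  and the service time \<open>Service n\<close> of customer \<open>n\<close>. Time is measured from the arrival of
  customer 0.
\<close>

datatype queue_input = Backlog | Interarrival nat | Service nat

definition arrival_time :: "(queue_input \<Rightarrow> 'w \<Rightarrow> real) \<Rightarrow> nat \<Rightarrow> 'w \<Rightarrow> real" where
  "arrival_time U n \<omega> = (\<Sum>k<n. U (Interarrival k) \<omega>)"

text \<open>
  First-come first-served with unlimited waiting space: the service of a customer starts as soon
  as the customer has arrived and the preceding customer has left.
\<close>

primrec service_start :: "(queue_input \<Rightarrow> 'w \<Rightarrow> real) \<Rightarrow> nat \<Rightarrow> 'w \<Rightarrow> real" where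
  "service_start U 0 \<omega> = arrival_time U 0 \<omega> + U Backlog \<omega>"
| "service_start U (Suc n) \<omega> =
     max (arrival_time U (Suc n) \<omega>) (service_start U n \<omega> + U (Service n) \<omega>)"

definition departure_time :: "(queue_input \<Rightarrow> 'w \<Rightarrow> real) \<Rightarrow> nat \<Rightarrow> 'w \<Rightarrow> real" where
  "departure_time U n \<omega> = service_start U n \<omega> + U (Service n) \<omega>"

definition waiting_time :: "(queue_input \<Rightarrow> 'w \<Rightarrow> real) \<Rightarrow> nat \<Rightarrow> 'w \<Rightarrow> real" where
  "waiting_time U n \<omega> = service_start U n \<omega> - arrival_time U n \<omega>"

definition sojourn_time :: "(queue_input \<Rightarrow> 'w \<Rightarrow> real) \<Rightarrow> nat \<Rightarrow> 'w \<Rightarrow> real" where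
  "sojourn_time U n \<omega> = departure_time U n \<omega> - arrival_time U n \<omega>"

lemma waiting_time_0: "waiting_time U 0 \<omega> = U Backlog \<omega>"
  by (simp add: waiting_time_def arrival_time_def)

text \<open>The Lindley recursion.\<close>

lemma waiting_time_Suc:
  "waiting_time U (Suc n) \<omega> =
     max 0 (waiting_time U n \<omega> + U (Service n) \<omega> - U (Interarrival n) \<omega>)"
  by (simp add: waiting_time_def arrival_time_def max_def)

lemma sojourn_time_eq: "sojourn_time U n \<omega> = waiting_time U n \<omega> + U (Service n) \<omega>"
  by (simp add: sojourn_time_def departure_time_def waiting_time_def)

context prob_space
begin

text \<open>
  The M/M/1 queue with arrival rate \<open>l > 0\<close> and service rate \<open>m > 0\<close>. The Poisson arrival process
  is given by its i.i.d. exponential interarrival times. The backlog may have any law on the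
  nonnegative reals.
\<close>

definition mm1_queue :: "real \<Rightarrow> real \<Rightarrow> (queue_input \<Rightarrow> 'a \<Rightarrow> real) \<Rightarrow> bool" where
  "mm1_queue l m U \<longleftrightarrow>
     0 < l \<and> 0 < m \<and>
     indep_vars (\<lambda>_. borel) U UNIV \<and>
     (AE \<omega> in M. 0 \<le> U Backlog \<omega>) \<and>
     (\<forall>n. distributed M lborel (U (Interarrival n)) (exponential_density l)) \<and>
     (\<forall>n. distributed M lborel (U (Service n)) (exponential_density m))"

text \<open>
  Stationarity from the customers' point of view: the law of the whole sequence of waiting times
  is invariant under a shift of the customer index.
\<close>

definition stationary_mm1_queue :: "real \<Rightarrow> real \<Rightarrow> (queue_input \<Rightarrow> 'a \<Rightarrow> real) \<Rightarrow> bool" where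
  "stationary_mm1_queue l m U \<longleftrightarrow>
     mm1_queue l m U \<and>
     distr M (Pi\<^sub>M UNIV (\<lambda>_. borel)) (\<lambda>\<omega> n. waiting_time U (Suc n) \<omega>) =
     distr M (Pi\<^sub>M UNIV (\<lambda>_. borel)) (\<lambda>\<omega> n. waiting_time U n \<omega>)"

end

definition routing_prob :: "nat \<Rightarrow> (nat \<Rightarrow> real) \<Rightarrow> nat \<Rightarrow> real" where
  "routing_prob R \<Lambda> r = \<Lambda> r / (\<Sum>r'\<in>{1..R}. \<Lambda> r')"

definition response_time :: "('d \<Rightarrow> real) \<Rightarrow> ('d \<Rightarrow> 'w \<Rightarrow> real) \<Rightarrow> 'd \<Rightarrow> 'w \<Rightarrow> real" where
  "response_time t T a \<omega> = t a + T a \<omega>"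

text \<open>
  Density of \<open>c + H\<close>, where \<open>H\<close> is hyperexponential: a mixture, with weights \<open>p i\<close>, of the
  exponential distributions with rates \<open>l i\<close>.
\<close>

definition shifted_hyperexponential_density ::
    "'i set \<Rightarrow> ('i \<Rightarrow> real) \<Rightarrow> ('i \<Rightarrow> real) \<Rightarrow> real \<Rightarrow> real \<Rightarrow> real" where
  "shifted_hyperexponential_density I p l c x = (\<Sum>i\<in>I. p i * exponential_density (l i) (x - c))"

end

theory Submission
  imports Defs
begin

text \<open>
  Everything rests on the stationary law of one M/M/1 queue. Let \<open>W\<close> be the stationary waiting
  time, \<open>S\<close> a service time and \<open>A\<close> an interarrival time, all independent, let \<open>V = W + S\<close> be the
  sojourn time, and write \<open>\<phi>\<close> and \<open>\<psi>\<close> for the characteristic functions of \<open>W\<close> and \<open>V\<close>.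
  Stationarity says that \<open>max 0 (V - A)\<close> has the law of \<open>W\<close>. Since \<open>A\<close> is exponential with rate
  \<open>l\<close>, integrating out \<open>A\<close> turns this into
  \<open>(l + \<i>u) \<phi>(u) = l \<psi>(u) + \<i>u C\<close> with the unknown constant \<open>C = E[exp (- l V)]\<close>
  (\<open>char_pos_part_diff_exponential\<close>), and independence of \<open>W\<close> and \<open>S\<close> gives
  \<open>\<psi>(u) = \<phi>(u) m / (m - \<i>u)\<close>. Eliminating \<open>\<phi>\<close> and dividing by \<open>\<i>u\<close> leaves
  \<open>\<psi>(u) = m C / (m - l - \<i>u)\<close> for \<open>u \<noteq> 0\<close>. Up to the factor this is the characteristic function
  of the exponential law with rate \<open>m - l\<close>; continuity at 0 fixes the factor, and Levy's uniqueness
  theorem identifies the law (\<open>stationary_mm1_sojourn_time\<close>). In particular the stationary law is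
  unique, since every stationary solution must have this transform.

  Given the regime, \<open>T\<close> is thus exponential with rate \<open>\<mu>\<^sub>r - \<Lambda>\<^sub>r\<close>, so by total probability its law is
  the mixture with weights \<open>\<pi>\<^sub>r\<close> (\<open>distributed_mixture\<close>); a regime without arrivals is chosen with
  probability 0. Adding the access time shifts the density. The distribution function and the mean
  are integrals against a mixture of shifted exponential densities, and so are weighted sums of
  the corresponding quantities of the components.
\<close>

section \<open>Characteristic functions and the exponential distribution\<close>

text \<open>
  All transforms of exponential laws below reduce to this integral: \<open>z = l - \<i>u\<close> and \<open>c = 0\<close> gives
  the characteristic function, and a tail \<open>c = v\<close> is cut off by the maximum in the Lindley recursion.
\<close>

lemma has_bochner_integral_exp_tail:
  fixes z :: complex and c :: real
  assumes z: "0 < Re z" and c: "0 \<le> c"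
  shows "has_bochner_integral lborel (\<lambda>x. indicator {c<..} x *\<^sub>R exp (- (z * of_real x)))
           (exp (- (z * of_real c)) / z)"
proof -
  have z0: "z \<noteq> 0" using z by auto
  let ?f = "\<lambda>x::real. exp (- (z * of_real x))"
  let ?F = "\<lambda>x::real. - (exp (- (z * of_real x)) / z)"
  have int: "set_integrable lborel {c<..} ?f"
  proof -
    have "set_integrable lborel {0<..} (\<lambda>x. exp (- (x * Re z)))"
      using integrable_I0i_exp_mscale[OF z] .
    then have "set_integrable lborel {c<..} (\<lambda>x. exp (- (x * Re z)))"
      by (rule set_integrable_subset) (use c in auto)
    then show ?thesis
      unfolding set_integrable_def
      by (rule Bochner_Integration.integrable_bound) (auto simp: indicator_def mult.commute)
  qed
  have lim: "((?F \<circ> real_of_ereal) \<longlongrightarrow> 0) (at_left \<infinity>)"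
  proof -
    have "((\<lambda>x. norm (?F x)) \<longlongrightarrow> 0) at_top"
    proof -
      have "((\<lambda>x::real. exp (- (Re z * x)) / norm z) \<longlongrightarrow> 0 / norm z) at_top"
        using z z0
        by (intro tendsto_intros filterlim_compose[OF exp_at_bot]
              filterlim_compose[OF filterlim_uminus_at_bot_at_top]
              filterlim_tendsto_pos_mult_at_top[OF tendsto_const _ filterlim_ident]) auto
      then show ?thesis
        by (simp add: norm_divide)
    qed
    then have "(?F \<longlongrightarrow> 0) at_top"
      by (rule tendsto_norm_zero_cancel)
    then show ?thesis
      unfolding ereal_tendsto_simps1 .
  qed
  have lim_c: "((?F \<circ> real_of_ereal) \<longlongrightarrow> ?F c) (at_right (ereal c))"
  proof -
    have "(?F \<longlongrightarrow> ?F c) (at_right c)"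
      using z0 by (intro tendsto_intros) auto
    then show ?thesis
      unfolding ereal_tendsto_simps1 .
  qed
  have "(LBINT x=ereal c..\<infinity>. ?f x) = 0 - ?F c"
  proof (rule interval_integral_FTC_integrable[OF _ _ _ _ lim_c lim])
    fix x :: real
    have "((\<lambda>w. - (exp (- (z * w)) / z)) has_field_derivative - (exp (- (z * of_real x)) * - z / z))
        (at (of_real x))"
      by (intro DERIV_minus DERIV_cdivide DERIV_fun_exp DERIV_cmult_Id)
    then have "((\<lambda>w. - (exp (- (z * w)) / z)) has_field_derivative ?f x) (at (of_real x))"
      using z0 by simp
    from has_vector_derivative_real_field[OF this]
    show "(?F has_vector_derivative ?f x) (at x)" .
    show "isCont ?f x"
      by (intro continuous_intros)
  qed (use int in auto)
  then show ?thesis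
    using int
    by (simp add: interval_integral_to_infinity_eq has_bochner_integral_iff set_integrable_def
        set_lebesgue_integral_def)
qed

lemma integral_exponential_density:
  fixes f :: "real \<Rightarrow> 'b::{banach, second_countable_topology}"
  assumes l: "0 < l" and [measurable]: "f \<in> borel_measurable borel"
  shows "integral\<^sup>L (density lborel (exponential_density l)) f =
           (\<integral>x. indicator {0<..} x *\<^sub>R ((l * exp (- (l * x))) *\<^sub>R f x) \<partial>lborel)"
proof -
  have "integral\<^sup>L (density lborel (exponential_density l)) f =
        (\<integral>x. exponential_density l x *\<^sub>R f x \<partial>lborel)"
    using l by (intro integral_density) (auto simp: exponential_density_nonneg)
  also have "\<dots> = (\<integral>x. indicator {0<..} x *\<^sub>R ((l * exp (- (l * x))) *\<^sub>R f x) \<partial>lborel)"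
    using AE_lborel_singleton[of "0::real"]
    by (intro integral_cong_AE) (auto simp: exponential_density_def indicator_def mult.commute)
  finally show ?thesis .
qed

lemma char_exponential:
  assumes l: "0 < l"
  shows "char (density lborel (exponential_density l)) u = of_real l / (of_real l - \<i> * of_real u)"
proof -
  let ?z = "of_real l - \<i> * of_real u"
  have "char (density lborel (exponential_density l)) u =
      (\<integral>x. indicator {0<..} x *\<^sub>R ((l * exp (- (l * x))) *\<^sub>R iexp (u * x)) \<partial>lborel)"
    unfolding char_def by (rule integral_exponential_density[OF l]) simp
  also have "\<dots> = (\<integral>x. of_real l * (indicator {0<..} x *\<^sub>R exp (- (?z * of_real x))) \<partial>lborel)"
    by (intro Bochner_Integration.integral_cong)
       (auto simp: indicator_def scaleR_conv_of_real exp_of_real[symmetric] exp_add[symmetric] algebra_simps)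
  also have "\<dots> = of_real l * (1 / ?z)"
    unfolding integral_mult_right_zero
    using has_bochner_integral_integral_eq[OF has_bochner_integral_exp_tail[of ?z 0]] l by simp
  finally show ?thesis by simp
qed

text \<open>
  One step of the Lindley recursion seen through the test function \<open>w \<mapsto> exp (\<i>uw)\<close>: the answer
  is a combination of the same test function and of \<open>exp (- l v)\<close>. The second term, which comes
  from arrivals that find an empty queue, is integrated over \<open>v\<close> into one unknown number, the same for every \<open>u\<close>.
\<close>

lemma exponential_integral_iexp_pos_part:
  assumes l: "0 < l" and v: "0 \<le> v"
  shows "(CLINT a|density lborel (exponential_density l). iexp (u * max 0 (v - a))) =
    (of_real l * iexp (u * v) + \<i> * of_real u * of_real (exp (- (l * v)))) / (of_real l + \<i> * of_real u)"
proof -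
  let ?z = "of_real l + \<i> * of_real u" and ?l = "of_real l"
  have z: "0 < Re ?z" "?z \<noteq> 0" using l by (auto simp: complex_eq_iff)
  have l': "0 < Re ?l" "?l \<noteq> 0" using l by auto
  let ?e = "\<lambda>c z (x::real). indicator {c<..} x *\<^sub>R exp (- (z * complex_of_real x))"
  \<comment> \<open>Without the maximum the integrand would be the first summand; the other two replace its part
    on \<open>a > v\<close>, where the maximum is 0, by the density alone.\<close>
  let ?g = "\<lambda>a. ?l * iexp (u * v) * ?e 0 ?z a + (?l * ?e v ?l a - ?l * iexp (u * v) * ?e v ?z a)"
  let ?G = "?l * iexp (u * v) * (exp (- (?z * of_real 0)) / ?z) +
     (?l * (exp (- (?l * of_real v)) / ?l) - ?l * iexp (u * v) * (exp (- (?z * of_real v)) / ?z))"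
  have "has_bochner_integral lborel ?g ?G"
    by (intro has_bochner_integral_add has_bochner_integral_diff has_bochner_integral_mult_right
          has_bochner_integral_exp_tail z l' v order_refl)
  then have G: "(\<integral>a. ?g a \<partial>lborel) = ?G"
    by (rule has_bochner_integral_integral_eq)
  have "(CLINT a|density lborel (exponential_density l). iexp (u * max 0 (v - a))) =
      (\<integral>a. indicator {0<..} a *\<^sub>R ((l * exp (- (l * a))) *\<^sub>R iexp (u * max 0 (v - a))) \<partial>lborel)"
    by (rule integral_exponential_density[OF l]) measurable
  also have "\<dots> = (\<integral>a. ?g a \<partial>lborel)"
    using v by (intro Bochner_Integration.integral_cong)
       (auto simp: indicator_def max_def scaleR_conv_of_real exp_of_real[symmetric] exp_add[symmetric]
          algebra_simps)
  also have "\<dots> = ?G" by (rule G)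
  also have "\<dots> = (?l * iexp (u * v) + \<i> * of_real u * of_real (exp (- (l * v)))) / ?z"
  proof -
    have e: "iexp (u * v) * exp (- (?z * of_real v)) = exp (- (?l * of_real v))"
      by (simp add: exp_add[symmetric] algebra_simps)
    have "?G = ?l * iexp (u * v) / ?z +
       (exp (- (?l * of_real v)) - ?l * (iexp (u * v) * exp (- (?z * of_real v))) / ?z)"
      using l by (simp add: mult_ac)
    also have "\<dots> = ?l * iexp (u * v) / ?z +
       (exp (- (?l * of_real v)) - ?l * exp (- (?l * of_real v)) / ?z)"
      unfolding e ..
    also have "\<dots> = (?l * iexp (u * v) + \<i> * of_real u * exp (- (?l * of_real v))) / ?z"
      using z(2) by (simp add: divide_simps) (simp add: algebra_simps)
    finally show ?thesis
      by (simp add: exp_of_real[symmetric])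
  qed
  finally show ?thesis .
qed

context prob_space
begin

text \<open>
  For \<open>V\<close> the sojourn time and \<open>A\<close> the next interarrival time, the left-hand side contains the
  transform of the next waiting time. This is the Lindley recursion as a linear equation between
  transforms, obtained from the previous lemma by integrating over the law of \<open>V\<close>.
\<close>

lemma char_pos_part_diff_exponential:
  fixes V A :: "'a \<Rightarrow> real"
  assumes ind: "indep_var borel A borel V"
    and A: "distributed M lborel A (exponential_density l)" and l: "0 < l"
    and V: "AE \<omega> in M. 0 \<le> V \<omega>"
  shows "(of_real l + \<i> * of_real u) * char (distr M borel (\<lambda>\<omega>. max 0 (V \<omega> - A \<omega>))) u =
     of_real l * char (distr M borel V) u + \<i> * of_real u * of_real (expectation (\<lambda>\<omega>. exp (- (l * V \<omega>))))"
proof -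
  let ?z = "of_real l + \<i> * of_real u"
  have z: "?z \<noteq> 0" using l by (auto simp: complex_eq_iff)
  have [measurable]: "A \<in> borel_measurable M" "V \<in> borel_measurable M"
    using ind by (auto dest: indep_var_rv1 indep_var_rv2)
  interpret DV: prob_space "distr M borel V" by (rule prob_space_distr) simp
  interpret DA: prob_space "distr M borel A" by (rule prob_space_distr) simp
  interpret P: pair_prob_space "distr M borel A" "distr M borel V" ..
  have dA: "distr M borel A = density lborel (exponential_density l)"
    using distributed_distr_eq_density[OF A] by (simp cong: distr_cong)
  have pair: "distr M borel A \<Otimes>\<^sub>M distr M borel V = distr M (borel \<Otimes>\<^sub>M borel) (\<lambda>\<omega>. (A \<omega>, V \<omega>))"
    using ind by (simp add: indep_var_distribution_eq)
  have "char (distr M borel (\<lambda>\<omega>. max 0 (V \<omega> - A \<omega>))) u = (CLINT \<omega>|M. iexp (u * max 0 (V \<omega> - A \<omega>)))"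
    unfolding char_def by (subst integral_distr) auto
  also have "\<dots> = (CLINT p|distr M (borel \<Otimes>\<^sub>M borel) (\<lambda>\<omega>. (A \<omega>, V \<omega>)). iexp (u * max 0 (snd p - fst p)))"
    by (subst integral_distr) auto
  also have "\<dots> = (CLINT p|distr M borel A \<Otimes>\<^sub>M distr M borel V. iexp (u * max 0 (snd p - fst p)))"
    unfolding pair ..
  also have "\<dots> = (CLINT v|distr M borel V. CLINT a|distr M borel A. iexp (u * max 0 (v - a)))"
    by (subst P.integral_snd) (auto simp: case_prod_beta' intro!: P.integrable_iexp)
  also have "\<dots> = (CLINT \<omega>|M. CLINT a|distr M borel A. iexp (u * max 0 (V \<omega> - a)))"
    by (subst integral_distr) (auto intro!: DA.borel_measurable_lebesgue_integral)
  also have "\<dots> = (CLINT \<omega>|M. (of_real l * iexp (u * V \<omega>) + \<i> * of_real u * of_real (exp (- (l * V \<omega>)))) / ?z)"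
  proof (rule integral_cong_AE)
    show "AE \<omega> in M. (CLINT a|distr M borel A. iexp (u * max 0 (V \<omega> - a))) =
      (of_real l * iexp (u * V \<omega>) + \<i> * of_real u * of_real (exp (- (l * V \<omega>)))) / ?z"
      using V by eventually_elim (simp only: dA exponential_integral_iexp_pos_part[OF l])
  qed (auto intro!: DA.borel_measurable_lebesgue_integral)
  also have "\<dots> = (of_real l * (CLINT \<omega>|M. iexp (u * V \<omega>)) +
       \<i> * of_real u * of_real (expectation (\<lambda>\<omega>. exp (- (l * V \<omega>))))) / ?z"
  proof -
    have 1: "integrable M (\<lambda>\<omega>. iexp (u * V \<omega>))"
      by (intro integrable_iexp) auto
    have 2: "integrable M (\<lambda>\<omega>. exp (- (l * V \<omega>)))"
      using V l by (intro integrable_const_bound[where B=1]) auto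
    show ?thesis
      using 1 2 by (simp add: integrable_of_real)
  qed
  also have "(CLINT \<omega>|M. iexp (u * V \<omega>)) = char (distr M borel V) u"
    unfolding char_def by (subst integral_distr) auto
  finally show ?thesis
    using z by simp
qed

end

text \<open>
  A transform found only up to a constant factor, and only where dividing by \<open>u\<close> is possible,
  still determines the law: a characteristic function is continuous with value 1 at 0, which
  forces \<open>K = b\<close>.
\<close>

lemma exponential_measure_eqI:
  assumes N: "real_distribution N" and b: "0 < b"
    and ch: "\<And>u. u \<noteq> 0 \<Longrightarrow> char N u = K / (of_real b - \<i> * of_real u)"
  shows "N = density lborel (exponential_density b)"
proof -
  let ?E = "density lborel (exponential_density b)"
  interpret N: real_distribution N by fact
  interpret E: real_distribution ?E
    using prob_space_exponential_density[OF b] by (simp add: real_distribution_def real_distribution_axioms_def)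
  have z: "of_real b - \<i> * of_real u \<noteq> 0" for u
    using b by (auto simp: complex_eq_iff)
  have "(char N \<longlongrightarrow> 1) (at 0)"
    using N.isCont_char[of 0] by (simp add: isCont_def N.char_zero)
  moreover have "((\<lambda>u. K / (of_real b - \<i> * of_real u)) \<longlongrightarrow> K / (of_real b - \<i> * of_real 0)) (at (0::real))"
    using z[of 0] by (intro tendsto_intros) auto
  then have "(char N \<longlongrightarrow> K / (of_real b - \<i> * of_real 0)) (at 0)"
    by (rule Lim_transform_eventually) (auto simp: ch eventually_at_filter)
  ultimately have "K / (of_real b - \<i> * of_real 0) = 1"
    using tendsto_unique[OF trivial_limit_at] by blast
  then have K: "K = of_real b" using b by (simp add: field_simps)
  have "char N = char ?E"
  proof
    fix u show "char N u = char ?E u"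
      by (cases "u = 0") (use b in \<open>simp_all add: ch char_exponential K N.char_zero E.char_zero\<close>)
  qed
  then show ?thesis
    using Levy_uniqueness N.real_distribution_axioms E.real_distribution_axioms by blast
qed

section \<open>The stationary sojourn time of the M/M/1 queue\<close>

context prob_space
begin

lemma waiting_time_measurable:
  assumes "\<And>i. U i \<in> borel_measurable M"
  shows "waiting_time U n \<in> borel_measurable M"
proof (induction n)
  case 0
  then show ?case using assms by (simp add: waiting_time_0 cong: measurable_cong)
next
  case (Suc n)
  note Suc[measurable] and assms[measurable]
  show ?case by (simp add: waiting_time_Suc cong: measurable_cong)
qed

lemma stationary_mm1_sojourn_time:
  assumes st: "stationary_mm1_queue l m U" and lm: "l < m"
  shows "distr M borel (sojourn_time U 0) = density lborel (exponential_density (m - l))"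
proof -
  have l: "0 < l" and m: "0 < m" and ind: "indep_vars (\<lambda>_. borel) U UNIV"
    and W0: "AE \<omega> in M. 0 \<le> U Backlog \<omega>"
    and A: "distributed M lborel (U (Interarrival 0)) (exponential_density l)"
    and S: "distributed M lborel (U (Service 0)) (exponential_density m)"
    and shift: "distr M (Pi\<^sub>M UNIV (\<lambda>_. borel)) (\<lambda>\<omega> n. waiting_time U (Suc n) \<omega>) =
     distr M (Pi\<^sub>M UNIV (\<lambda>_. borel)) (\<lambda>\<omega> n. waiting_time U n \<omega>)"
    using st by (auto simp: stationary_mm1_queue_def mm1_queue_def)
  have U[measurable]: "U i \<in> borel_measurable M" for i
    using ind by (auto simp: indep_vars_def)
  note waiting_time_measurable[of U, OF U, measurable]
  let ?V = "sojourn_time U 0"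
  have V: "?V = (\<lambda>\<omega>. U Backlog \<omega> + U (Service 0) \<omega>)"
    by (simp add: fun_eq_iff sojourn_time_eq waiting_time_0)
  have "prob {\<omega> \<in> space M. 0 < U (Service 0) \<omega>} = 1"
    using exponential_distributedD_gt[OF S order_refl m] by simp
  then have S0: "AE \<omega> in M. 0 \<le> U (Service 0) \<omega>"
    by (subst (asm) prob_Collect_eq_1) auto
  have V0: "AE \<omega> in M. 0 \<le> ?V \<omega>"
    using W0 S0 by (auto simp: V)
  have indA: "indep_var borel (U (Interarrival 0)) borel ?V"
    using indep_vars_sum[of "{Backlog, Service 0}" "Interarrival 0" U]
      indep_vars_subset[OF ind] by (simp add: V)
  have indS: "indep_var borel (U Backlog) borel (U (Service 0))"
    using indep_vars_sum[of "{Service 0}" "Backlog" U]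
      indep_vars_subset[OF ind] by simp
  \<comment> \<open>Stationarity of the sequence of waiting times, projected to the coordinate 0.\<close>
  have inv: "distr M borel (\<lambda>\<omega>. max 0 (?V \<omega> - U (Interarrival 0) \<omega>)) = distr M borel (U Backlog)"
  proof -
    have "distr (distr M (Pi\<^sub>M UNIV (\<lambda>_. borel)) (\<lambda>\<omega> n. waiting_time U (k + n) \<omega>)) borel (\<lambda>w. w 0)
        = distr M borel (waiting_time U k)" for k
      by (subst distr_distr) (auto simp: comp_def intro!: measurable_PiM_single')
    from this[of 1] this[of 0] show ?thesis
      using shift by (simp add: waiting_time_Suc sojourn_time_eq waiting_time_0 cong: distr_cong)
  qed
  \<comment> \<open>Unknown here; the normalization at \<open>u = 0\<close> below amounts to \<open>C = (m - l) / m\<close>.\<close>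
  let ?C = "complex_of_real (expectation (\<lambda>\<omega>. exp (- (l * ?V \<omega>))))"
  show ?thesis
  proof (rule exponential_measure_eqI)
    show "real_distribution (distr M borel ?V)" by (simp add: V)
    show "0 < m - l" using lm by simp
    fix u :: real assume u: "u \<noteq> 0"
    let ?\<phi> = "char (distr M borel (U Backlog)) u" and ?\<psi> = "char (distr M borel ?V) u"
    have z: "of_real m - \<i> * of_real u \<noteq> 0" "of_real (m - l) - \<i> * of_real u \<noteq> 0" 
      using m lm by (auto simp: complex_eq_iff)
    have lindley: "(of_real l + \<i> * of_real u) * ?\<phi> = of_real l * ?\<psi> + \<i> * of_real u * ?C"
      using char_pos_part_diff_exponential[OF indA A l V0, of u] by (simp add: inv)
    have "distr M borel (U (Service 0)) = density lborel (exponential_density m)"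
      using distributed_distr_eq_density[OF S] by (simp cong: distr_cong)
    then have "?\<psi> = ?\<phi> * (of_real m / (of_real m - \<i> * of_real u))"
      unfolding V using char_distr_add[OF indS] char_exponential[OF m] by simp
    then have \<psi>: "of_real m * ?\<phi> = ?\<psi> * (of_real m - \<i> * of_real u)"
      using z by (simp add: field_simps)
    \<comment> \<open>\<open>(l + \<i>u) (m - \<i>u) - l m = \<i>u (m - l - \<i>u)\<close>: the factor \<open>\<i>u\<close> cancels against the right-hand
      side, and the other factor is the denominator of an exponential transform of rate \<open>m - l\<close>.\<close>
    have "\<i> * of_real u * (?\<psi> * (of_real (m - l) - \<i> * of_real u)) = \<i> * of_real u * (of_real m * ?C)"
    proof -
      have "(of_real l + \<i> * of_real u) * (?\<psi> * (of_real m - \<i> * of_real u)) =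
          of_real m * (of_real l * ?\<psi> + \<i> * of_real u * ?C)"
        unfolding lindley[symmetric] \<psi>[symmetric] by (simp add: mult_ac)
      then show ?thesis by (simp add: algebra_simps)
    qed
    then have "?\<psi> * (of_real (m - l) - \<i> * of_real u) = of_real m * ?C"
      using u by simp
    then show "?\<psi> = of_real m * ?C / (of_real (m - l) - \<i> * of_real u)"
      using z(2) by (simp add: field_simps)
  qed
qed

end

section \<open>Mixtures and shifted hyperexponential distributions\<close>

context prob_space
begin

text \<open>
  Total probability over the label \<open>Z\<close>. The hypothesis is in product form because a conditional law
  has no content for labels of probability 0.
\<close>

lemma distributed_mixture:
  fixes f :: "'i \<Rightarrow> real \<Rightarrow> real" and p :: "'i \<Rightarrow> real"
  assumes I: "finite I" and Z: "Z \<in> measurable M (count_space I)"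
    and T: "T \<in> borel_measurable M"
    and f: "\<And>i. i \<in> I \<Longrightarrow> f i \<in> borel_measurable borel" "\<And>i x. i \<in> I \<Longrightarrow> 0 \<le> f i x"
    and p: "\<And>i. i \<in> I \<Longrightarrow> 0 \<le> p i"
    and eq: "\<And>i B. i \<in> I \<Longrightarrow> B \<in> sets borel \<Longrightarrow>
      emeasure M {\<omega> \<in> space M. T \<omega> \<in> B \<and> Z \<omega> = i} = ennreal (p i) * emeasure (density lborel (f i)) B"
  shows "distributed M lborel T (\<lambda>x. \<Sum>i\<in>I. p i * f i x)"
  unfolding distributed_def
proof (intro conjI measure_eqI)
  note [measurable] = Z T f(1)
  show "random_variable lborel T" by simp
  show "(\<lambda>x. ennreal (\<Sum>i\<in>I. p i * f i x)) \<in> borel_measurable lborel" by measurable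
  fix B assume "B \<in> sets (distr M lborel T)"
  then have B[measurable]: "B \<in> sets borel" by simp
  have "emeasure (distr M lborel T) B = emeasure M (T -` B \<inter> space M)"
    by (subst emeasure_distr) auto
  also have "T -` B \<inter> space M = (\<Union>i\<in>I. {\<omega> \<in> space M. T \<omega> \<in> B \<and> Z \<omega> = i})"
    using measurable_space[OF Z] by auto
  also have "emeasure M \<dots> = (\<Sum>i\<in>I. emeasure M {\<omega> \<in> space M. T \<omega> \<in> B \<and> Z \<omega> = i})"
    by (intro sum_emeasure[symmetric] I) (auto simp: disjoint_family_on_def)
  also have "\<dots> = (\<Sum>i\<in>I. \<integral>\<^sup>+x. ennreal (p i * f i x) * indicator B x \<partial>lborel)"
  proof (intro sum.cong refl)
    fix i assume i: "i \<in> I"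
    then show "emeasure M {\<omega> \<in> space M. T \<omega> \<in> B \<and> Z \<omega> = i} =
        (\<integral>\<^sup>+x. ennreal (p i * f i x) * indicator B x \<partial>lborel)"
      by (subst eq) (auto simp: emeasure_density nn_integral_cmult[symmetric] ennreal_mult f p mult.assoc)
  qed
  also have "\<dots> = (\<integral>\<^sup>+x. ennreal (\<Sum>i\<in>I. p i * f i x) * indicator B x \<partial>lborel)"
    by (subst nn_integral_sum[symmetric])
       (auto simp: f p sum_distrib_right[symmetric] sum_ennreal)
  also have "\<dots> = emeasure (density lborel (\<lambda>x. ennreal (\<Sum>i\<in>I. p i * f i x))) B"
    by (subst emeasure_density) auto
  finally show "emeasure (distr M lborel T) B = \<dots>" .
qed simp

end

text \<open>
  Integration against the mixture is linear in the components, and the shift moves into \<open>g\<close>. An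
  indicator for \<open>g\<close> yields the distribution function, the identity yields the mean.
\<close>

lemma has_bochner_integral_shifted_hyperexponential:
  fixes g :: "real \<Rightarrow> real"
  assumes l: "\<And>i. i \<in> I \<Longrightarrow> 0 < l i" and [measurable]: "g \<in> borel_measurable borel"
    and g: "\<And>i. i \<in> I \<Longrightarrow>
      has_bochner_integral (density lborel (exponential_density (l i))) (\<lambda>y. g (c + y)) (v i)"
  shows "has_bochner_integral lborel (\<lambda>x. shifted_hyperexponential_density I p l c x * g x)
           (\<Sum>i\<in>I. p i * v i)"
proof -
  have "has_bochner_integral lborel (\<lambda>x. p i * (exponential_density (l i) (x - c) * g x)) (p i * v i)"
    if i: "i \<in> I" for i
  proof (rule has_bochner_integral_mult_right)
    have "has_bochner_integral lborel (\<lambda>y. exponential_density (l i) y *\<^sub>R g (c + y)) (v i)"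
      using g[OF i] l[OF i]
      by (simp add: has_bochner_integral_iff integrable_density integral_density exponential_density_nonneg)
    then show "has_bochner_integral lborel (\<lambda>x. exponential_density (l i) (x - c) * g x) (v i)"
      by (subst lborel_has_bochner_integral_real_affine_iff[of 1 _ _ c]) auto
  qed
  then show ?thesis
    unfolding shifted_hyperexponential_density_def sum_distrib_right mult.assoc
    by (rule has_bochner_integral_sum)
qed

context prob_space
begin

lemma has_bochner_integral_distributed_shifted_hyperexponential:
  fixes g :: "real \<Rightarrow> real"
  assumes X: "distributed M lborel X (shifted_hyperexponential_density I p l c)"
    and p: "\<And>i. i \<in> I \<Longrightarrow> 0 \<le> p i" and l: "\<And>i. i \<in> I \<Longrightarrow> 0 < l i"
    and g': "g \<in> borel_measurable borel"
    and g: "\<And>i. i \<in> I \<Longrightarrow>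
      has_bochner_integral (density lborel (exponential_density (l i))) (\<lambda>y. g (c + y)) (v i)"
  shows "has_bochner_integral M (\<lambda>\<omega>. g (X \<omega>)) (\<Sum>i\<in>I. p i * v i)"
proof -
  have "0 \<le> shifted_hyperexponential_density I p l c x" for x
    by (auto simp: shifted_hyperexponential_density_def intro!: sum_nonneg mult_nonneg_nonneg p
        exponential_density_nonneg l)
  then show ?thesis
    using has_bochner_integral_shifted_hyperexponential[OF l g' g, of I] g'
    by (simp add: has_bochner_integral_iff distributed_integrable[OF X, symmetric]
        distributed_integral[OF X, symmetric])
qed

lemma shifted_hyperexponential_cdf:
  assumes X: "distributed M lborel X (shifted_hyperexponential_density I p l c)"
    and p: "\<And>i. i \<in> I \<Longrightarrow> 0 \<le> p i" "(\<Sum>i\<in>I. p i) = 1" and l: "\<And>i. i \<in> I \<Longrightarrow> 0 < l i"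
  shows "\<P>(\<omega> in M. X \<omega> \<le> x) = (if x < c then 0 else 1 - (\<Sum>i\<in>I. p i * exp (- l i * (x - c))))"
proof -
  have [measurable]: "X \<in> borel_measurable M"
    using distributed_measurable[OF X] by simp
  have "has_bochner_integral M (\<lambda>\<omega>. indicator {..x} (X \<omega>) :: real) (\<Sum>i\<in>I. p i * erlang_CDF 0 (l i) (x - c))"
  proof (rule has_bochner_integral_distributed_shifted_hyperexponential[OF X p(1) l])
    fix i assume i: "i \<in> I"
    let ?E = "density lborel (exponential_density (l i))"
    interpret E: prob_space ?E by (rule prob_space_exponential_density[OF l[OF i]])
    have "(\<lambda>y. indicator {..x} (c + y) :: real) = indicator {..x - c}"
      by (auto simp: indicator_def)
    moreover have "measure ?E {..x - c} = erlang_CDF 0 (l i) (x - c)"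
      using emeasure_erlang_density[OF l[OF i], of 0 "x - c"]
      by (simp add: measure_def erlang_CDF_nonneg l[OF i])
    moreover have "has_bochner_integral ?E (indicator {..x - c}) (measure ?E {..x - c})"
      by (rule has_bochner_integral_real_indicator) (auto simp: less_top[symmetric])
    ultimately show "has_bochner_integral ?E (\<lambda>y. indicator {..x} (c + y) :: real) (erlang_CDF 0 (l i) (x - c))"
      by (simp only:)
  qed auto
  then have "expectation (\<lambda>\<omega>. indicator {..x} (X \<omega>)) = (\<Sum>i\<in>I. p i * erlang_CDF 0 (l i) (x - c))"
    by (rule has_bochner_integral_integral_eq)
  moreover have "expectation (\<lambda>\<omega>. indicator {..x} (X \<omega>) :: real) = \<P>(\<omega> in M. X \<omega> \<le> x)"
  proof -
    have "expectation (\<lambda>\<omega>. indicator {..x} (X \<omega>) :: real) = expectation (indicator {\<omega> \<in> space M. X \<omega> \<le> x})"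
      by (intro Bochner_Integration.integral_cong) (auto simp: indicator_def)
    then show ?thesis by simp
  qed
  ultimately show ?thesis
    using p(2) by (auto simp: erlang_CDF_0 right_diff_distrib sum_subtractf intro!: sum.neutral)
qed

lemma shifted_hyperexponential_mean:
  assumes X: "distributed M lborel X (shifted_hyperexponential_density I p l c)"
    and p: "\<And>i. i \<in> I \<Longrightarrow> 0 \<le> p i" "(\<Sum>i\<in>I. p i) = 1" and l: "\<And>i. i \<in> I \<Longrightarrow> 0 < l i"
  shows "has_bochner_integral M X (c + (\<Sum>i\<in>I. p i / l i))"
proof -
  have "has_bochner_integral M (\<lambda>\<omega>. X \<omega>) (\<Sum>i\<in>I. p i * (c + 1 / l i))"
  proof (rule has_bochner_integral_distributed_shifted_hyperexponential[OF X p(1) l])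
    fix i assume i: "i \<in> I"
    let ?E = "density lborel (exponential_density (l i))"
    interpret E: prob_space ?E by (rule prob_space_exponential_density[OF l[OF i]])
    have "distributed ?E lborel (\<lambda>x. x) (exponential_density (l i))"
      by (auto simp: distributed_def intro!: distr_id2)
    from E.has_bochner_integral_erlang_ith_moment[OF l[OF i] this, of 1]
    have "has_bochner_integral ?E (\<lambda>x. x) (1 / l i)" by simp
    moreover have "has_bochner_integral ?E (\<lambda>_. c) c"
      using E.prob_space by (simp add: has_bochner_integral_iff)
    ultimately show "has_bochner_integral ?E (\<lambda>y. c + y) (c + 1 / l i)"
      by (intro has_bochner_integral_add)
  qed auto
  also have "(\<Sum>i\<in>I. p i * (c + 1 / l i)) = c + (\<Sum>i\<in>I. p i / l i)"
    using p(2) by (simp add: distrib_left sum.distrib sum_distrib_right[symmetric])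
  finally show ?thesis by simp
qed

end

section \<open>The response time\<close>

theorem theorem1:
  fixes M :: "'w measure"
    and \<A> :: "'d set" and R :: nat
    and \<Lambda> \<mu> :: "nat \<Rightarrow> real" and t :: "'d \<Rightarrow> real"
    and U :: "nat \<Rightarrow> queue_input \<Rightarrow> 'w \<Rightarrow> real"
    and Z :: "'d \<Rightarrow> 'w \<Rightarrow> nat" and T :: "'d \<Rightarrow> 'w \<Rightarrow> real"
  assumes "prob_space M"
    and "finite \<A>"
    and "\<And>r. r \<in> {1..R} \<Longrightarrow> 0 \<le> \<Lambda> r"
    and "0 < (\<Sum>r\<in>{1..R}. \<Lambda> r)"
    and "\<And>r. r \<in> {1..R} \<Longrightarrow> 0 < \<mu> r"
    and "\<And>r. r \<in> {1..R} \<Longrightarrow> \<Lambda> r < \<mu> r"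
    and "\<And>a. a \<in> \<A> \<Longrightarrow> 0 \<le> t a"
    \<comment> \<open>a regime with arrival rate 0 has no customers, hence no sojourn times to describe\<close>
    and "\<And>r. r \<in> {1..R} \<Longrightarrow> 0 < \<Lambda> r \<Longrightarrow>
           prob_space.stationary_mm1_queue M (\<Lambda> r) (\<mu> r) (U r)"
    and "prob_space.indep_vars M (\<lambda>_. Pi\<^sub>M UNIV (\<lambda>_. borel)) (\<lambda>r \<omega> i. U r i \<omega>)
           {r \<in> {1..R}. 0 < \<Lambda> r}"
    and "\<And>a. a \<in> \<A> \<Longrightarrow> Z a \<in> measurable M (count_space {1..R})"
    and "\<And>a. a \<in> \<A> \<Longrightarrow> T a \<in> borel_measurable M"
    and "\<And>a r. a \<in> \<A> \<Longrightarrow> r \<in> {1..R} \<Longrightarrow>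
           \<P>(\<omega> in M. Z a \<omega> = r) = routing_prob R \<Lambda> r"
    \<comment> \<open>by stationarity, customer 0 of regime \<open>r\<close> stands for any customer of that regime\<close>
    and "\<And>a r B. a \<in> \<A> \<Longrightarrow> r \<in> {1..R} \<Longrightarrow> 0 < \<Lambda> r \<Longrightarrow> B \<in> sets borel \<Longrightarrow>
           \<P>(\<omega> in M. T a \<omega> \<in> B \<bar> Z a \<omega> = r) = \<P>(\<omega> in M. sojourn_time (U r) 0 \<omega> \<in> B)"
  shows "\<forall>a\<in>\<A>.
           distributed M lborel (response_time t T a)
             (shifted_hyperexponential_density {1..R} (routing_prob R \<Lambda>) (\<lambda>r. \<mu> r - \<Lambda> r) (t a)) \<and>
           (\<forall>x. \<P>(\<omega> in M. response_time t T a \<omega> \<le> x) =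
                 (if x < t a then 0
                  else 1 - (\<Sum>r\<in>{1..R}. routing_prob R \<Lambda> r * exp (- (\<mu> r - \<Lambda> r) * (x - t a))))) \<and>
           integrable M (response_time t T a) \<and>
           (\<integral>\<omega>. response_time t T a \<omega> \<partial>M) =
             t a + (\<Sum>r\<in>{1..R}. routing_prob R \<Lambda> r / (\<mu> r - \<Lambda> r))"
proof (intro ballI)
  fix a assume a: "a \<in> \<A>"
  interpret prob_space M by fact
  let ?I = "{1..R}" and ?\<pi> = "routing_prob R \<Lambda>" and ?b = "\<lambda>r. \<mu> r - \<Lambda> r"
  note \<Lambda> = assms(3,4,6) and Z = assms(10)[OF a] and T = assms(11)[OF a]
  have \<pi>: "0 \<le> ?\<pi> r" if "r \<in> ?I" for r
    using \<Lambda>(1,2) that by (simp add: routing_prob_def)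
  have \<pi>_sum: "(\<Sum>r\<in>?I. ?\<pi> r) = 1"
    using \<Lambda>(2) by (simp add: routing_prob_def sum_divide_distrib[symmetric])
  have b: "0 < ?b r" if "r \<in> ?I" for r
    using \<Lambda>(3) that by simp
  note [measurable] = Z T
  have joint: "emeasure M {\<omega> \<in> space M. T a \<omega> \<in> B \<and> Z a \<omega> = r} =
      ennreal (?\<pi> r) * emeasure (density lborel (exponential_density (?b r))) B"
    if r: "r \<in> ?I" and B[measurable]: "B \<in> sets borel" for r B
  proof (cases "\<Lambda> r = 0")
    case True
    \<comment> \<open>Conditioning on this regime is void, but both sides vanish because it is never selected.\<close>
    then have "prob {\<omega> \<in> space M. Z a \<omega> = r} = 0"
      using assms(12)[OF a r] by (simp add: routing_prob_def)
    then have "prob {\<omega> \<in> space M. T a \<omega> \<in> B \<and> Z a \<omega> = r} \<le> 0"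
      using finite_measure_mono[of "{\<omega> \<in> space M. T a \<omega> \<in> B \<and> Z a \<omega> = r}"
          "{\<omega> \<in> space M. Z a \<omega> = r}"] by (simp add: subset_eq)
    then show ?thesis
      using True by (simp add: routing_prob_def emeasure_eq_measure measure_le_0_iff)
  next
    case False
    then have pos: "0 < \<Lambda> r" using \<Lambda>(1)[OF r] by simp
    then have \<pi>_pos: "0 < ?\<pi> r" using \<Lambda>(2) by (simp add: routing_prob_def)
    have st: "stationary_mm1_queue (\<Lambda> r) (\<mu> r) (U r)" by (rule assms(8)[OF r pos])
    have "U r i \<in> borel_measurable M" for i
      using st by (auto simp: stationary_mm1_queue_def mm1_queue_def indep_vars_def)
    then have [measurable]: "sojourn_time (U r) 0 \<in> borel_measurable M"
      by (simp add: sojourn_time_eq waiting_time_0 cong: measurable_cong)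
    have "prob {\<omega> \<in> space M. T a \<omega> \<in> B \<and> Z a \<omega> = r} =
        ?\<pi> r * prob {\<omega> \<in> space M. sojourn_time (U r) 0 \<omega> \<in> B}"
      using \<pi>_pos unfolding assms(13)[OF a r pos B, symmetric] cond_prob_def assms(12)[OF a r]
      by simp
    moreover have "emeasure M {\<omega> \<in> space M. sojourn_time (U r) 0 \<omega> \<in> B} =
        emeasure (density lborel (exponential_density (?b r))) B"
      unfolding stationary_mm1_sojourn_time[OF st \<Lambda>(3)[OF r], symmetric]
      by (subst emeasure_distr) (auto intro!: arg_cong[where f="emeasure M"])
    ultimately show ?thesis
      using \<pi>_pos by (simp add: emeasure_eq_measure ennreal_mult)
  qed
  have dT: "distributed M lborel (T a) (\<lambda>x. \<Sum>r\<in>?I. ?\<pi> r * exponential_density (?b r) x)"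
    by (rule distributed_mixture[OF _ Z T _ _ \<pi> joint]) (simp_all add: exponential_density_nonneg[OF b])
  have resp: "distributed M lborel (response_time t T a)
      (shifted_hyperexponential_density ?I ?\<pi> ?b (t a))"
    using distributed_affine[OF dT, of 1 "t a"]
    by (simp add: divide_ennreal_def response_time_def[abs_def] shifted_hyperexponential_density_def[abs_def])
  note cdf = shifted_hyperexponential_cdf[OF resp \<pi> \<pi>_sum b]
  note mean = shifted_hyperexponential_mean[OF resp \<pi> \<pi>_sum b, unfolded has_bochner_integral_iff]
  show "distributed M lborel (response_time t T a)
             (shifted_hyperexponential_density {1..R} (routing_prob R \<Lambda>) (\<lambda>r. \<mu> r - \<Lambda> r) (t a)) \<and>
           (\<forall>x. \<P>(\<omega> in M. response_time t T a \<omega> \<le> x) =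
                 (if x < t a then 0
                  else 1 - (\<Sum>r\<in>{1..R}. routing_prob R \<Lambda> r * exp (- (\<mu> r - \<Lambda> r) * (x - t a))))) \<and>
           integrable M (response_time t T a) \<and>
           (\<integral>\<omega>. response_time t T a \<omega> \<partial>M) =
             t a + (\<Sum>r\<in>{1..R}. routing_prob R \<Lambda> r / (\<mu> r - \<Lambda> r))"
    by (intro conjI allI resp cdf mean[THEN conjunct1] mean[THEN conjunct2])
qed

end
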